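(* Let $p,q,r,s\ge 3$ be four pairwise coprime prime powers. Then ${\cal C}(\Phi^*_{pqr})$ is a set of consecutive integers. Moreover, if $r,s>\max(p,q)$, then ${\cal C}(\Phi^*_{pqr})={\cal C}(\Phi^*_{pqs})$ if $r\equiv s\pmod{pq}$, and ${\cal C}(\Phi^*_{pqr})=-{\cal C}(\Phi^*_{pqs})$ if $r\equiv -s\pmod{pq}$. If $r\equiv \pm s\pmod{pq}$ and $r>\max(p,q)>s\ge 3$, then $$H(\Phi^*_{pqs})\le H(\Phi^*_{pqr})\le H(\Phi^*_{pqs})+1.$$
   Context: A divisor $d$ of $n$ is unitary, $d\,\|\,n$, if $\gcd(d,n/d)=1$; $\mu^*(n)=(-1)^{\omega(n)}$ with $\omega(n)$ the number of distinct prime factors of $n$; $\Phi^*_n(x)=\prod_{d\,\|\,n}(x^d-1)^{\mu^*(n/d)}$ is the unitary cyclotomic polynomial (an integer polynomial). For a polynomial $f$, ${\cal C}(f)$ is the set of all its coefficients (coefficients of $x^j$ for $0\le j\le\deg f$), $-{\cal C}(f)=\{-c:c\in{\cal C}(f)\}$, and $H(f)=\max\{|c|:c\in{\cal C}(f)\}$. *)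

theory Defs
  imports "HOL-Number_Theory.Number_Theory" "HOL-Computational_Algebra.Computational_Algebra"
begin

definition unitary_divisor :: "nat \<Rightarrow> nat \<Rightarrow> bool" where
  "unitary_divisor d n \<longleftrightarrow> d dvd n \<and> gcd d (n div d) = 1"

definition omega :: "nat \<Rightarrow> nat" where
  "omega n = card (prime_factors n)"

definition unitary_mu :: "nat \<Rightarrow> int" where
  "unitary_mu n = (-1) ^ omega n"

text \<open>
  The factors occur with exponents \<open>1\<close> and \<open>-1\<close>, so the defining product is taken in the
  fraction field of the integer polynomials; \<open>unitary_cyclotomic n\<close> is the (unique) integer
  polynomial whose image under the injective map \<open>to_fract\<close> is that product.
\<close>

definition unitary_cyclotomic :: "nat \<Rightarrow> int poly" where
  "unitary_cyclotomic n =
     (THE f. to_fract f =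
        (\<Prod>d | unitary_divisor d n. to_fract (monom 1 d - 1) powi unitary_mu (n div d)))"

text \<open>
  Coefficients are taken up to the degree only, so that \<open>0\<close> belongs to the set only if
  it occurs there (\<open>range (coeff f)\<close> would always contain \<open>0\<close>).
\<close>

definition coeff_set :: "int poly \<Rightarrow> int set" where
  "coeff_set f = {coeff f j | j. j \<le> degree f}"

definition height :: "int poly \<Rightarrow> int" where
  "height f = Max {\<bar>c\<bar> | c. c \<in> coeff_set f}"

end

theory Submission
  imports Defs
begin

text \<open>
  Put \<open>Q(x) = (1 - x)(1 - x^pq) / ((1 - x^p)(1 - x^q))\<close>. The polynomial in question is
  \<open>Q(x^r) / Q(x)\<close>, so its coefficient at \<open>n\<close> is the sum of \<open>a(j) \<chi>(n - r j)\<close> over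
  \<open>j \<le> n div r\<close>, where \<open>a(j)\<close> are the coefficients of \<open>Q\<close> and \<open>\<chi>\<close> is the function
  of period \<open>pq\<close> that is the indicator of \<open>[0, p)\<close> minus that of \<open>[q, p + q)\<close>.
  Let \<open>S(M, m)\<close> be the sum of \<open>a(j) \<chi>(m - r j)\<close> over \<open>j < M\<close>; it depends on \<open>r\<close> only modulo
  \<open>pq\<close>, and replacing \<open>r\<close> by \<open>-r\<close> only changes its sign and reflects \<open>m\<close>.

  Writing exponents as \<open>ip + kq\<close> turns \<open>S(M, m) - S(M, m - 1)\<close> into an alternating sum over the four
  corners of a rectangle, which is at most \<open>1\<close> in absolute value; hence consecutive coefficients
  differ by at most \<open>1\<close> and the coefficient set is an interval.

  \<open>S(M + 1, m)\<close> is visibly a coefficient if \<open>t = (m - r M) mod pq\<close> is less than \<open>r\<close>. For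
  \<open>t \<ge> p + q\<close> the last summand vanishes, which allows to decrease \<open>M\<close>. In the remaining
  window \<open>r \<le> t < p + q\<close> the function \<open>\<chi>\<close> is constant on long stretches, and the sums of
  \<open>a\<close> over intervals are \<open>-1\<close>, \<open>0\<close> or \<open>1\<close>, since the partial sums of \<open>a\<close> are \<open>0\<close> or \<open>1\<close>.
  So \<open>S\<close> differs by at most \<open>1\<close> from a coefficient; if \<open>r > max(p, q)\<close>, then
  it even lies between two coefficients and therefore is one.
\<close>

section \<open>Unitary divisors\<close>

lemma unitary_divisor_iff: "unitary_divisor d n \<longleftrightarrow> d dvd n \<and> coprime d (n div d)"
  unfolding unitary_divisor_def by (simp only: coprime_iff_gcd_eq_1)

lemma unitary_divisor_one: "{d. unitary_divisor d 1} = {1}"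
  by (auto simp: unitary_divisor_def)

lemma finite_unitary_divisors: "n > 0 \<Longrightarrow> finite {d. unitary_divisor d n}"
  by (rule finite_subset[of _ "{d. d dvd n}"]) (auto simp: unitary_divisor_def)

text \<open>The prime under \<open>m\<close> cannot divide both \<open>d\<close> and its
  complementary divisor, so \<open>m\<close> goes wholly into one of the two.\<close>

lemma unitary_divisors_primepow_mult:
  fixes m n :: nat
  assumes "primepow m" "coprime m n" "n > 0"
  shows "{d. unitary_divisor d (m * n)} =
    {d. unitary_divisor d n} \<union> (*) m ` {d. unitary_divisor d n}"
proof (intro equalityI subsetI)
  obtain P a where P: "prime P" "a > 0" "m = P ^ a"
    using assms(1) by (auto simp: primepow_def)
  fix d assume "d \<in> {d. unitary_divisor d (m * n)}"
  then have d: "d dvd m * n" "coprime d (m * n div d)"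
    by (auto simp: unitary_divisor_iff)
  define e where "e = m * n div d"
  have de: "d * e = m * n" using d by (simp add: e_def)
  have m0: "m > 0" using P by (simp add: prime_gt_0_nat)
  have d0: "d > 0" using d(1) m0 assms(3) by (auto intro: Nat.gr0I)
  have ce: "coprime d e" using d by (simp add: e_def)
  show "d \<in> {d. unitary_divisor d n} \<union> (*) m ` {d. unitary_divisor d n}"
  proof (cases "P dvd d")
    case True
    then have "\<not> P dvd e"
      using ce P(1) by (meson coprime_common_divisor not_prime_unit)
    then have "coprime m e"
      using P by (simp add: prime_imp_coprime)
    moreover have "m dvd d * e" using de by simp
    ultimately have "m dvd d"
      using coprime_dvd_mult_left_iff by blast
    then obtain d' where d': "d = m * d'" by blast
    have "d' * e = n" using de m0 d' by simp
    moreover have "d' > 0" using d0 d' by (cases d') auto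
    ultimately have "d' dvd n" "n div d' = e" by auto
    moreover have "coprime d' e" using ce d' by simp
    ultimately have "unitary_divisor d' n"
      by (simp add: unitary_divisor_iff)
    then show ?thesis using d' by blast
  next
    case False
    then have "coprime d m"
      using P by (metis coprime_commute coprime_power_left_iff prime_imp_coprime)
    then have "d dvd n" using d(1) coprime_dvd_mult_right_iff by blast
    moreover have "e = m * (n div d)" using \<open>d dvd n\<close>
      by (simp add: e_def div_mult_swap)
    then have "coprime d (n div d)" using ce by simp
    ultimately show ?thesis by (simp add: unitary_divisor_iff)
  qed
next
  have m0: "m > 0" using assms(1) primepow_gt_0_nat by blast
  fix d assume "d \<in> {d. unitary_divisor d n} \<union> (*) m ` {d. unitary_divisor d n}"
  then consider "unitary_divisor d n" | d' where "d = m * d'" "unitary_divisor d' n" by auto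
  then show "d \<in> {d. unitary_divisor d (m * n)}"
  proof cases
    case 1
    then have "d dvd n" "coprime d (n div d)"
      by (auto simp: unitary_divisor_iff)
    moreover have "coprime d m" 
      using \<open>d dvd n\<close> assms(2) by (meson coprime_commute coprime_divisors dvd_refl)
    ultimately show ?thesis
      by (simp add: unitary_divisor_iff flip: div_mult_swap)
  next
    case 2
    then have "d' dvd n" "coprime d' (n div d')"
      by (auto simp: unitary_divisor_iff)
    moreover have "n div d' dvd n" using \<open>d' dvd n\<close>
      by (metis dvd_div_mult_self dvd_triv_left)
    then have "coprime m (n div d')" 
      using assms(2) by (meson coprime_divisors dvd_refl)
    ultimately show ?thesis using m0 2(1)
      by (simp add: unitary_divisor_iff)
  qed
qed

lemma unitary_mu_primepow_mult:
  fixes m n :: nat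
  assumes "primepow m" "coprime m n" "n > 0"
  shows "unitary_mu (m * n) = - unitary_mu n"
proof -
  have m0: "m > 0" using assms(1) primepow_gt_0_nat by blast
  obtain P a where P: "prime P" "a > 0" "m = P ^ a"
    using assms(1) by (auto simp: primepow_def)
  have "prime_factors (m * n) = insert P (prime_factors n)"
    using P m0 assms(3) by (auto simp: prime_factors_product prime_factors_power prime_prime_factors)
  moreover have "P \<notin> prime_factors n"
  proof
    assume "P \<in> prime_factors n"
    then have "P dvd n" by auto
    moreover have "P dvd m" using P by simp
    ultimately show False
      using assms(2) P(1) by (meson coprime_common_divisor not_prime_unit)
  qed
  ultimately show ?thesis by (simp add: unitary_mu_def omega_def)
qed

text \<open>The divisor \<open>m * d\<close> keeps the complementary divisor \<open>n div d\<close>;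
  that of \<open>d\<close> gains the factor \<open>m\<close>, which flips the exponent.
  \<open>F\<close> is arbitrary so that further prime powers can be split off with
  \<open>\<lambda>d. F (m * d)\<close>.\<close>

lemma prod_unitary_divisors_primepow_mult:
  fixes F :: "nat \<Rightarrow> 'a :: field"
  assumes "primepow m" "coprime m n" "n > 0"
  shows "(\<Prod>d | unitary_divisor d (m * n). F d powi unitary_mu (m * n div d)) =
    (\<Prod>d | unitary_divisor d n. F (m * d) powi unitary_mu (n div d)) /
    (\<Prod>d | unitary_divisor d n. F d powi unitary_mu (n div d))"
proof -
  let ?U = "{d. unitary_divisor d n}"
  have m0: "m > 0" using assms(1) primepow_gt_0_nat by blast
  have fin: "finite ?U" using assms(3) by (rule finite_unitary_divisors)
  have "?U \<inter> (*) m ` ?U = {}"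
  proof -
    have "\<not> m dvd n"
      using assms(1,2) by (metis coprime_absorb_left nat_dvd_1_iff_1 not_primepow_Suc_0_nat One_nat_def)
    then show ?thesis by (auto simp: unitary_divisor_def dest: dvd_mult_left)
  qed
  then have "(\<Prod>d | unitary_divisor d (m * n). F d powi unitary_mu (m * n div d)) =
    (\<Prod>d\<in>?U. F d powi unitary_mu (m * n div d)) *
    (\<Prod>d\<in>(*) m ` ?U. F d powi unitary_mu (m * n div d))"
    using fin by (simp add: unitary_divisors_primepow_mult[OF assms] prod.union_disjoint)
  also have "(\<Prod>d\<in>(*) m ` ?U. F d powi unitary_mu (m * n div d)) =
    (\<Prod>d | unitary_divisor d n. F (m * d) powi unitary_mu (n div d))"
    using m0 by (subst prod.reindex) (auto simp: inj_on_def)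
  also have "(\<Prod>d\<in>?U. F d powi unitary_mu (m * n div d)) =
    (\<Prod>d\<in>?U. inverse (F d powi unitary_mu (n div d)))"
  proof (rule prod.cong[OF refl])
    fix d assume "d \<in> ?U"
    then have d: "d dvd n" by (simp add: unitary_divisor_def)
    then have "n div d > 0" "n div d dvd n"
      using assms(3) by (auto simp: dvd_div_eq_0_iff intro: Nat.gr0I)
    then have "unitary_mu (m * (n div d)) = - unitary_mu (n div d)"
      using assms by (meson unitary_mu_primepow_mult coprime_divisors dvd_refl)
    then show "F d powi unitary_mu (m * n div d) = inverse (F d powi unitary_mu (n div d))"
      using d by (simp add: power_int_minus flip: div_mult_swap)
  qed
  finally show ?thesis by (simp add: divide_inverse mult.commute flip: prod_inversef[unfolded o_def])
qed

text \<open>Splitting off \<open>p\<close>, \<open>q\<close> and \<open>r\<close> in turn turns the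
  defining product into an iterated quotient; the assumption on \<open>f\<close> is this with
  denominators cleared. Uniqueness for \<open>THE\<close> comes from injectivity of
  \<open>to_fract\<close>.\<close>

lemma unitary_cyclotomic_ternary_eqI:
  fixes p q r :: nat
  assumes "primepow p" "primepow q" "primepow r"
    and "coprime p q" "coprime p r" "coprime q r"
    and f: "f * ((monom 1 1 - 1) * (monom 1 (p * q) - 1) * (monom 1 (p * r) - 1) * (monom 1 (q * r) - 1))
      = (monom 1 p - 1) * (monom 1 q - 1) * (monom 1 r - 1) * (monom 1 (p * q * r) - 1 :: int poly)"
  shows "unitary_cyclotomic (p * q * r) = f"
proof -
  define F where "F d = to_fract (monom 1 d - 1 :: int poly)" for d
  have pos: "p > 0" "q > 0" "r > 0" using assms primepow_gt_0_nat by blast+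
  have nz: "F d \<noteq> 0" if "d > 0" for d
  proof -
    have "coeff (monom 1 d - 1 :: int poly) d \<noteq> 0" using that by simp
    then show ?thesis unfolding F_def by (metis coeff_0 to_fract_eq_0_iff)
  qed
  have g0: "(\<Prod>d | unitary_divisor d 1. G d powi unitary_mu (1 div d)) = G 1"
    for G :: "nat \<Rightarrow> int poly fract"
    by (simp add: unitary_divisor_one[unfolded One_nat_def] unitary_mu_def omega_def)
  have g1: "(\<Prod>d | unitary_divisor d r. G d powi unitary_mu (r div d)) = G r / G 1"
    for G :: "nat \<Rightarrow> int poly fract"
    using prod_unitary_divisors_primepow_mult[of r 1 G] g0 assms by simp
  have g2: "(\<Prod>d | unitary_divisor d (q * r). G d powi unitary_mu (q * r div d)) =
      (G (q * r) / G q) / (G r / G 1)"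
    for G :: "nat \<Rightarrow> int poly fract"
    using prod_unitary_divisors_primepow_mult[of q r G] pos assms
    by (simp add: g1[of G] g1[of "\<lambda>d. G (q * d)"])
  have g3: "(\<Prod>d | unitary_divisor d (p * (q * r)). F d powi unitary_mu (p * (q * r) div d)) =
     (F (p * (q * r)) / F (p * q)) / (F (p * r) / F p) / ((F (q * r) / F q) / (F r / F 1))"
    using prod_unitary_divisors_primepow_mult[of p "q * r" F] pos assms
    by (simp add: g2[of F] g2[of "\<lambda>d. F (p * d)"])
  have "to_fract f * (F 1 * F (p * q) * F (p * r) * F (q * r)) = F p * F q * F r * F (p * q * r)"
    using arg_cong[OF f, of to_fract] unfolding F_def by (simp del: to_fract_diff)
  then have "to_fract f = 
     (F (p * (q * r)) / F (p * q)) / (F (p * r) / F p) / ((F (q * r) / F q) / (F r / F 1))"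
    using nz[of 1] nz[of "p * q"] nz[of "p * r"] nz[of "q * r"] nz[of p] nz[of q] nz[of r] pos
    by (simp add: field_simps)
  then have *: "to_fract f =
      (\<Prod>d | unitary_divisor d (p * q * r). F d powi unitary_mu (p * q * r div d))"
    using g3 by (simp add: mult.assoc)
  show ?thesis unfolding unitary_cyclotomic_def
    using *[unfolded F_def] by (intro the_equality) (auto simp del: to_fract_diff simp flip: *[unfolded F_def])
qed

section \<open>The coefficients of the binary polynomial\<close>

lemma sum_lessThan_add: "(\<Sum>i<m + n. f i) = (\<Sum>i<m. f i) + (\<Sum>i<n. f (m + i))"
  for f :: "nat \<Rightarrow> 'a :: comm_monoid_add"
  by (induction n) (simp_all add: add.assoc)

lemma sum_power_mult: "(\<Sum>i<n. z ^ (i * k)) * (1 - z ^ k) = 1 - z ^ (n * k)"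
  for z :: "'a :: comm_ring_1"
  using one_diff_power_eq[of "z ^ k" n] by (simp add: mult.commute flip: power_mult)

lemma unique_index:
  fixes a m :: int and b :: nat
  assumes "coprime a (int b)" "b > 0"
  obtains i where "i < b" "\<And>j. j < b \<Longrightarrow> int b dvd m - a * int j \<longleftrightarrow> j = i"
proof -
  obtain x where x: "[a * x = m] (mod int b)"
    using assms cong_solve_coprime_int[OF assms(1)] by (metis cong_scalar_right mult.assoc mult_1)
  define i where "i = nat (x mod int b)"
  have i: "i < b" "int i = x mod int b" using assms(2) by (simp_all add: i_def nat_less_iff)
  have "int b dvd m - a * int j \<longleftrightarrow> j = i" if "j < b" for j
  proof -
    have "int b dvd m - a * int j \<longleftrightarrow> [m = a * int j] (mod int b)" by (simp add: cong_iff_dvd_diff)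
    also have "\<dots> \<longleftrightarrow> [a * x = a * int j] (mod int b)" using x by (meson cong_sym cong_trans)
    also have "\<dots> \<longleftrightarrow> [x = int j] (mod int b)" using assms(1) by (simp add: cong_mult_lcancel)
    also have "\<dots> \<longleftrightarrow> int i = int j" using i that by (simp add: cong_def)
    finally show ?thesis by auto
  qed
  then show ?thesis using that i by blast
qed

text \<open>The power series of 1 / (1 - x^k) for \<open>k > 0\<close>.\<close>

definition geo :: "nat \<Rightarrow> int fps" where
  "geo k = Abs_fps (\<lambda>j. of_bool (k dvd j))"

lemma geo_mult: "(1 - fps_X ^ k) * geo k = 1" if "k > 0"
proof (rule fps_ext)
  fix j
  show "((1 - fps_X ^ k) * geo k) $ j = 1 $ j"
  proof (cases "j < k")
    case True
    then have "k dvd j \<longleftrightarrow> j = 0" by (auto dest: dvd_imp_le)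
    then show ?thesis using True by (simp add: algebra_simps fps_X_power_mult_nth geo_def)
  next
    case False
    then show ?thesis using that by (simp add: algebra_simps fps_X_power_mult_nth geo_def dvd_minus_self)
  qed
qed

lemma interval_of_unit_steps:
  fixes f :: "nat \<Rightarrow> int"
  assumes step: "\<And>j. \<bar>f (Suc j) - f j\<bar> \<le> 1" and fin: "finite (range f)"
  shows "\<exists>a b. range f = {a..b}"
proof (intro exI equalityI subsetI)
  fix x assume "x \<in> range f"
  then show "x \<in> {Min (range f)..Max (range f)}" using fin by simp
next
  fix x assume x: "x \<in> {Min (range f)..Max (range f)}"
  obtain i j where "f i = Min (range f)" "f j = Max (range f)"
    using fin by (metis Max_in Min_in UNIV_not_empty image_is_empty rangeE)
  with x have ij: "f i \<le> x" "x \<le> f j" by simp_all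
  show "x \<in> range f"
  proof (cases "i \<le> j")
    case True
    then show ?thesis
      using nat_intermed_int_val[of i j f x] step ij by (metis rangeI)
  next
    case False
    \<comment> \<open>If the maximum is attained before the minimum, the intermediate value theorem
      is applied to \<open>- f\<close>.\<close>
    have "\<bar>- f (Suc k) - - f k\<bar> \<le> 1" for k using step[of k] by linarith
    then obtain k where "- f k = - x"
      using nat_intermed_int_val[of j i "\<lambda>k. - f k" "- x"] ij False by fastforce
    then show ?thesis by (metis neg_equal_iff_equal rangeI)
  qed
qed

text \<open>Here \<open>u\<close> and \<open>v\<close> are inverses of \<open>p\<close> modulo
  \<open>q\<close> and of \<open>q\<close> modulo \<open>p\<close>. They cut the \<open>q\<close> by
  \<open>p\<close> grid into four blocks; \<open>Q\<close> lives on two opposite ones, with weights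
  1 and -1.\<close>

locale binary_grid =
  fixes p q u v :: nat
  assumes p: "p \<ge> 2" and q: "q \<ge> 2" and cop: "coprime p q"
    and uq: "u \<le> q" and vp: "v \<le> p" and uv: "u * p + v * q = p * q + 1"
begin

text \<open>
  \<open>Q\<close> is the sum of \<open>wt i k * x ^ ex i k\<close> over \<open>i < q\<close>, \<open>k < p\<close>. The truncated subtraction
  in \<open>ex\<close> is exact whenever \<open>wt i k\<close> is nonzero.
\<close>

definition wt :: "nat \<Rightarrow> nat \<Rightarrow> int" where
  "wt i k = of_bool (i < u) + of_bool (k < v) - 1"

definition ex :: "nat \<Rightarrow> nat \<Rightarrow> nat" where
  "ex i k = (if i < u \<and> k < v then i * p + k * q else i * p + k * q - p * q)"

lemma upper_ge: "p * q + 1 \<le> i * p + k * q" if "u \<le> i" "v \<le> k"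
  using uv add_mono[OF mult_right_mono[OF that(1), of p] mult_right_mono[OF that(2), of q]] by simp

text \<open>Both blocks of nonzero weight are products of geometric sums, which telescope. The rest
  collapses by \<open>v * q = u' * p + 1\<close> and \<open>u * p = v' * q + 1\<close>, where
  \<open>u' = q - u\<close> and \<open>v' = p - v\<close>. The ring is general so that
  \<open>y\<close> may be a power of \<open>fps_X\<close>.\<close>

lemma grid_product:
  fixes y :: "'a :: comm_ring_1"
  shows "(\<Sum>i<q. \<Sum>k<p. of_int (wt i k) * y ^ ex i k) * ((1 - y ^ p) * (1 - y ^ q)) =
    (1 - y) * (1 - y ^ (p * q))"
proof -
  define f where "f i k = of_int (wt i k) * y ^ ex i k" for i k
  obtain u' v' where u': "q = u + u'" and v': "p = v + v'"
    using uq vp by (metis le_add_diff_inverse)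
  have f1: "f i k = y ^ (i * p) * y ^ (k * q)" if "i < u" "k < v" for i k
    using that by (simp add: f_def wt_def ex_def power_add)
  have f2: "f i (v + k) = 0" if "i < u" for i k
    using that by (simp add: f_def wt_def)
  have f3: "f (u + i) k = 0" if "k < v" for i k
    using that by (simp add: f_def wt_def)
  \<comment> \<open>The upper block starts at exponent \<open>u * p + v * q - p * q = 1\<close>,
    hence the extra factor \<open>y\<close>.\<close>
  have f4: "f (u + i) (v + k) = - (y * (y ^ (i * p) * y ^ (k * q)))" for i k
  proof -
    have "(u + i) * p + (v + k) * q - p * q = 1 + i * p + k * q"
      using uv by (simp add: algebra_simps)
    then show ?thesis by (simp add: f_def wt_def ex_def power_add)
  qed
  have "(\<Sum>i<q. \<Sum>k<p. f i k) = (\<Sum>i<u. \<Sum>k<v. f i k) + (\<Sum>i<u'. \<Sum>k<v'. f (u + i) (v + k))"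
    unfolding u' v' by (simp add: sum_lessThan_add f2 f3 sum.distrib)
  also have "\<dots> = (\<Sum>i<u. y ^ (i * p)) * (\<Sum>k<v. y ^ (k * q)) -
      y * ((\<Sum>i<u'. y ^ (i * p)) * (\<Sum>k<v'. y ^ (k * q)))"
    unfolding sum_product by (simp add: f1 f4 sum_negf sum_distrib_left)
  finally have sums: "(\<Sum>i<q. \<Sum>k<p. f i k) = (\<Sum>i<u. y ^ (i * p)) * (\<Sum>k<v. y ^ (k * q)) -
      y * ((\<Sum>i<u'. y ^ (i * p)) * (\<Sum>k<v'. y ^ (k * q)))" .
  have "(\<Sum>i<q. \<Sum>k<p. f i k) * ((1 - y ^ p) * (1 - y ^ q)) =
      ((\<Sum>i<u. y ^ (i * p)) * (1 - y ^ p)) * ((\<Sum>k<v. y ^ (k * q)) * (1 - y ^ q)) -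
      y * (((\<Sum>i<u'. y ^ (i * p)) * (1 - y ^ p)) * ((\<Sum>k<v'. y ^ (k * q)) * (1 - y ^ q)))"
  proof -
    have "(A * B - z * (C * D)) * (a * b) = (A * a) * (B * b) - z * ((C * a) * (D * b))"
      for A B C D a b z :: 'a by (simp add: algebra_simps)
    then show ?thesis by (simp only: sums)
  qed
  also have "\<dots> = (1 - y ^ (u * p)) * (1 - y ^ (v * q)) - y * ((1 - y ^ (u' * p)) * (1 - y ^ (v' * q)))"
    by (simp only: sum_power_mult)
  also have "\<dots> = (1 - y) * (1 - y ^ (p * q))"
  proof -
    have "v * q = u' * p + 1" "u * p = v' * q + 1" "p * q = u' * p + v' * q + 1"
      using uv u' v' by (simp_all add: algebra_simps)
    then have "y ^ (v * q) = y ^ (u' * p) * y" "y ^ (u * p) = y ^ (v' * q) * y"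
       "y ^ (p * q) = y ^ (u' * p) * y ^ (v' * q) * y"
      by (simp_all only: power_add power_one_right)
    moreover have "(1 - B * y) * (1 - A * y) - y * ((1 - A) * (1 - B)) = (1 - y) * (1 - A * B * y)"
      for A B by (simp add: algebra_simps)
    ultimately show ?thesis by (simp only:)
  qed
  finally show ?thesis by (simp add: f_def)
qed

lemma ex_less: "i < q \<Longrightarrow> k < p \<Longrightarrow> ex i k < p * q"
proof (cases "i < u \<and> k < v")
  case True
  then have "Suc i * p \<le> u * p" "Suc k * q \<le> v * q" by (simp_all only: mult_le_mono1 Suc_leI)
  then show ?thesis using True uv p q by (simp add: ex_def)
next
  case False
  assume "i < q" "k < p"
  then have "Suc i * p \<le> q * p" "Suc k * q \<le> p * q" by (simp_all only: mult_le_mono1 Suc_leI)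
  then have "i * p + k * q - p * q < p * q" using p q by (simp add: mult.commute)
  then show ?thesis unfolding ex_def using False by (simp only: if_False)
qed

lemma ex_cong: "wt i k \<noteq> 0 \<Longrightarrow> int (p * q) dvd int (ex i k) - (int i * int p + int k * int q)"
proof -
  assume "wt i k \<noteq> 0"
  then consider "i < u" "k < v" | "u \<le> i" "v \<le> k"
    by (auto simp: wt_def of_bool_def split: if_splits)
  then show ?thesis
  proof cases
    case 1
    then show ?thesis by (simp add: ex_def)
  next
    case 2
    then have "int (ex i k) = int i * int p + int k * int q - int (p * q)"
      using upper_ge[OF 2] by (simp add: ex_def of_nat_diff)
    then show ?thesis by simp
  qed
qed

definition W :: "nat \<Rightarrow> nat \<Rightarrow> nat \<Rightarrow> int" where
  "W M i k = wt i k * of_bool (ex i k < M)"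

text \<open>For \<open>i \<le> i'\<close> the difference \<open>W M i l - W M i' l\<close> does not
  change sign with \<open>l\<close>: truncation removes larger exponents first, and weights are 0 or
  1 below \<open>u\<close>, 0 or -1 from \<open>u\<close> on. Two values from {0, 1}, or two from
  {0, -1}, differ by at most 1.\<close>

lemma W_rectangle: "\<bar>W M i k - W M i' k - W M i k' + W M i' k'\<bar> \<le> 1"
proof (induction i i' rule: linorder_wlog)
  case (le i i')
  have lower: "i * p + l * q - c < M" if "i' * p + l * q - c < M" for l c
    using le that by (meson add_right_mono diff_le_mono le_less_trans mult_right_mono zero_le)
  have "(\<forall>l. W M i l - W M i' l \<in> {0, 1}) \<or> (\<forall>l. W M i l - W M i' l \<in> {0, - 1})"
  proof -
    consider "i' < u" | "i < u" "u \<le> i'" | "u \<le> i" by linarith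
    then show ?thesis
    proof cases
      case 1
      with le have "W M i l - W M i' l \<in> {0, 1}" for l
        using lower[of l 0] by (auto simp: W_def wt_def ex_def of_bool_def)
      then show ?thesis by blast
    next
      case 2
      then have "W M i l - W M i' l \<in> {0, 1}" for l
        by (auto simp: W_def wt_def ex_def of_bool_def)
      then show ?thesis by blast
    next
      case 3
      with le have "W M i l - W M i' l \<in> {0, - 1}" for l
        using lower[of l "p * q"] by (auto simp: W_def wt_def ex_def of_bool_def)
      then show ?thesis by blast
    qed
  qed
  then show ?case by (smt (verit) insert_iff empty_iff)
qed (simp add: abs_minus_commute algebra_simps)

text \<open>Without truncation \<open>W\<close> is \<open>wt\<close>, a function of \<open>i\<close>
  plus a function of \<open>k\<close>, whose mixed differences vanish.\<close>

lemma W_rectangle_total: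
  assumes "M \<ge> p * q" "i < q" "i' < q" "k < p" "k' < p"
  shows "W M i k - W M i' k - W M i k' + W M i' k' = 0"
proof -
  have "W M i k = wt i k" if "i < q" "k < p" for i k
    using ex_less[OF that] assms(1) by (simp add: W_def)
  then show ?thesis using assms by (simp add: wt_def)
qed

section \<open>Truncated coefficient sums\<close>


lemma pq_neq: "p \<noteq> q" using cop p by auto

lemma sum_lt_pq: "p + q < p * q"
proof -
  obtain a b where "p = a + 2" "q = b + 2" using p q by (metis add.commute le_add_diff_inverse)
  moreover then have "a \<noteq> 0 \<or> b \<noteq> 0" using pq_neq by auto
  ultimately show ?thesis by (auto simp: algebra_simps)
qed

definition N :: int where "N = int (p * q)"

lemma N_gt: "int p + int q < N"
  unfolding N_def using sum_lt_pq by linarith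

lemma N_pos [simp]: "0 < N"
  using N_gt by linarith

section \<open>The periodic function \<open>chi\<close>\<close>

definition chi :: "int \<Rightarrow> int" where
  "chi z = of_bool (z mod N < int p) - of_bool ((z - int q) mod N < int p)"

lemma chi_cong: "chi y = chi z" if "N dvd y - z"
proof -
  have "y mod N = z mod N" using that by (simp add: mod_eq_dvd_iff)
  moreover have "N dvd (y - int q) - (z - int q)" using that by simp
  then have "(y - int q) mod N = (z - int q) mod N" by (simp only: mod_eq_dvd_iff)
  ultimately show ?thesis by (simp add: chi_def)
qed

lemma chi_mod [simp]: "chi (z mod N) = chi z"
  by (rule chi_cong) (simp add: mod_eq_dvd_iff[symmetric])

lemma chi_eq:
  assumes "0 \<le> z" "z < N"
  shows "chi z = of_bool (z < int p) - of_bool (int q \<le> z \<and> z < int p + int q)"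
proof -
  note N_gt
  moreover have "(z - int q) mod N = (if z < int q then z - int q + N else z - int q)"
  proof (cases "z < int q")
    case True
    have "(z - int q) mod N = (z - int q + N) mod N" by simp
    also have "\<dots> = z - int q + N" using True assms N_gt by (intro mod_pos_pos_trivial) linarith+
    finally show ?thesis using True by simp
  qed (use assms in simp)
  ultimately show ?thesis using assms by (auto simp: chi_def)
qed

lemma chi_minus_one [simp]: "chi (- 1) = 0"
  using chi_eq[of "N - 1"] chi_cong[of "- 1" "N - 1"] N_gt p q by simp

lemma chi_step:
  "chi z - chi (z - 1) = of_bool (N dvd z) - of_bool (N dvd z - int p)
    - of_bool (N dvd z - int q) + of_bool (N dvd z - int p - int q)"
proof -
  have *: "of_bool (z mod N < int p) - of_bool ((z - 1) mod N < int p) =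
     of_bool (N dvd z) - (of_bool (N dvd z - int p) :: int)" for z
  proof -
    define t where "t = z mod N"
    have N: "N > int p" "int p > 1" using N_gt p by linarith+
    have t: "0 \<le> t" "t < N" using N by (simp_all add: t_def)
    have "N dvd z \<longleftrightarrow> t = 0" by (simp add: t_def dvd_eq_mod_eq_0)
    moreover have "N dvd z - int p \<longleftrightarrow> t = int p"
      using N by (simp add: t_def flip: mod_eq_dvd_iff)
    moreover have "(z - 1) mod N = (t - 1) mod N" by (simp add: t_def mod_diff_left_eq)
    moreover have "(t - 1) mod N = (if t = 0 then N - 1 else t - 1)"
      using t N zmod_minus1[of N] by (auto intro: mod_pos_pos_trivial)
    ultimately show ?thesis using t N by (auto simp flip: t_def)
  qed
  have "z - 1 - int q = z - int q - 1" "z - int p - int q = z - int q - int p" by simp_all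
  then show ?thesis using *[of z] *[of "z - int q"] unfolding chi_def by (simp only:)
qed

text \<open>The reflection exchanges the windows [0, p) and [q, p + q), which enter with opposite
  signs.\<close>

lemma chi_reflect: "chi (int p + int q - 1 - z) = - chi z"
proof -
  have *: "(int p - 1 - z) mod N < int p \<longleftrightarrow> z mod N < int p" for z
  proof -
    define t where "t = z mod N"
    have N: "N > int p" "int p > 1" using N_gt p by linarith+
    have t: "0 \<le> t" "t < N" using N by (simp_all add: t_def)
    have "(int p - 1 - z) mod N = (int p - 1 - t) mod N" by (simp add: t_def mod_diff_right_eq)
    also have "\<dots> = (if t < int p then int p - 1 - t else int p - 1 - t + N)"
    proof (cases "t < int p")
      case False
      have "(int p - 1 - t) mod N = (int p - 1 - t + N) mod N" by simp
      also have "\<dots> = int p - 1 - t + N" using False t N by (intro mod_pos_pos_trivial) linarith+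
      finally show ?thesis using False by simp
    qed (use N t in simp)
    finally show ?thesis using t N by (auto simp: t_def[symmetric])
  qed
  have "int p + int q - 1 - z = int p - 1 - (z - int q)"
    "int p + int q - 1 - z - int q = int p - 1 - z" by simp_all
  then show ?thesis by (simp only: chi_def *)
qed

lemma sum_chi: "(\<Sum>m<p * q. chi (int m + c)) = 0"
proof -
  define g where "g z = (of_bool (z mod N < int p) :: int)" for z
  have *: "(\<Sum>m<p * q. g (int m + c)) = (\<Sum>m<p * q. g (int m))" for c
  proof -
    have 1: "g (int m + c) = g (int (nat ((int m + c) mod N)))" for m
      by (simp add: g_def)
    have "(\<Sum>m<p * q. g (int m + c)) = (\<Sum>m<p * q. g (int (nat ((int m + c) mod N))))"
      by (simp only: 1[symmetric])
    also have "\<dots> = (\<Sum>m<p * q. g (int m))"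
    proof (rule sum.reindex_bij_witness[of _ "\<lambda>m. nat ((int m - c) mod N)" "\<lambda>m. nat ((int m + c) mod N)"])
      fix a assume "a \<in> {..<p * q}"
      then have a: "int a mod N = int a"
        by (simp add: N_def flip: of_nat_mult of_nat_mod)
      show "nat ((int (nat ((int a + c) mod N)) - c) mod N) = a"
        "nat ((int (nat ((int a - c) mod N)) + c) mod N) = a"
        using a by (simp_all add: mod_diff_left_eq mod_add_left_eq)
      show "nat ((int a + c) mod N) \<in> {..<p * q}" "nat ((int a - c) mod N) \<in> {..<p * q}"
        using pos_mod_bound[OF N_pos]
        by (simp_all add: nat_less_iff del: of_nat_mult flip: N_def)
    qed simp
    finally show ?thesis .
  qed
  have "(\<Sum>m<p * q. chi (int m + c)) = (\<Sum>m<p * q. g (int m + c)) - (\<Sum>m<p * q. g (int m + (c - int q)))"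
    by (simp add: chi_def g_def sum_subtractf algebra_simps)
  then show ?thesis by (simp only: *)
qed

text \<open>Summing over cells instead of exponents avoids asking whether distinct cells have
  distinct exponents. \<open>r\<close> is an integer so that \<open>- r\<close> can be
  inserted.\<close>

definition S :: "int \<Rightarrow> nat \<Rightarrow> int \<Rightarrow> int" where
  "S r M m = (\<Sum>i<q. \<Sum>k<p. W M i k * chi (m - r * int (ex i k)))"

text \<open>The partial sum of the coefficients of \<open>Q\<close> at exponents below \<open>M\<close>.\<close>

definition psum :: "nat \<Rightarrow> int" where
  "psum M = (\<Sum>i<q. \<Sum>k<p. W M i k)"

lemma W_0 [simp]: "W 0 i k = 0"
  by (simp add: W_def)

lemma S_0 [simp]: "S r 0 m = 0"
  by (simp add: S_def)

text \<open>The difference \<open>psum (Suc M) - psum M\<close> is the coefficient of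
  \<open>Q\<close> at \<open>M\<close>; in this form later sums of coefficients telescope.\<close>

lemma S_Suc: "S r (Suc M) m = S r M m + (psum (Suc M) - psum M) * chi (m - r * int M)"
proof -
  have W: "W (Suc M) i k = W M i k + wt i k * of_bool (ex i k = M)" for i k
    by (auto simp: W_def)
  have "W (Suc M) i k * chi (m - r * int (ex i k)) = W M i k * chi (m - r * int (ex i k)) +
     wt i k * of_bool (ex i k = M) * chi (m - r * int M)" for i k
    by (cases "ex i k = M") (simp_all add: W algebra_simps)
  then have "S r (Suc M) m = S r M m +
    (\<Sum>i<q. \<Sum>k<p. wt i k * of_bool (ex i k = M)) * chi (m - r * int M)"
    by (simp only: S_def sum.distrib sum_distrib_right)
  moreover have "psum (Suc M) - psum M = (\<Sum>i<q. \<Sum>k<p. wt i k * of_bool (ex i k = M))"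
    by (simp add: psum_def W sum.distrib)
  ultimately show ?thesis by simp
qed

lemma S_cong: "S r M m = S r' M m'" if "N dvd r - r'" "N dvd m - m'"
proof -
  have "chi (m - r * e) = chi (m' - r' * e)" for e
  proof (rule chi_cong)
    have "(m - r * e) - (m' - r' * e) = (m - m') - (r - r') * e" by (simp add: algebra_simps)
    then show "N dvd (m - r * e) - (m' - r' * e)" using that by (metis dvd_diff dvd_mult2)
  qed
  then show ?thesis by (simp add: S_def)
qed

lemma S_uminus: "S (- r) M m = - S r M (int p + int q - 1 - m)"
proof -
  have "chi (m - - r * e) = - chi (int p + int q - 1 - m - r * e)" for e
    using chi_reflect[of "m - - r * e"] by (simp add: algebra_simps)
  then show ?thesis by (simp only: S_def sum_negf mult_minus_right)
qed

text \<open>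
  The second difference of \<open>\<chi>\<close> in \<open>chi_step\<close> is supported on four residues; by the Chinese remainder
  theorem each of them is hit by exactly one cell of the grid.
\<close>

lemma S_step_rectangle:
  assumes "coprime r N"
  obtains i i' k k' where "i < q" "i' < q" "k < p" "k' < p"
    "\<And>M. S r M m - S r M (m - 1) = W M i k - W M i' k - W M i k' + W M i' k'"
proof -
  have cq: "coprime (r * int p) (int q)" and cp: "coprime (r * int q) (int p)"
    using assms cop by (simp_all add: N_def coprime_commute)
  obtain i where i: "i < q" "\<And>j. j < q \<Longrightarrow> int q dvd m - r * int p * int j \<longleftrightarrow> j = i"
    using unique_index[OF cq] q by (metis less_le_trans zero_less_numeral)
  obtain i' where i': "i' < q" "\<And>j. j < q \<Longrightarrow> int q dvd m - int p - r * int p * int j \<longleftrightarrow> j = i'"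
    using unique_index[OF cq] q by (metis less_le_trans zero_less_numeral)
  obtain k where k: "k < p" "\<And>j. j < p \<Longrightarrow> int p dvd m - r * int q * int j \<longleftrightarrow> j = k"
    using unique_index[OF cp] p by (metis less_le_trans zero_less_numeral)
  obtain k' where k': "k' < p" "\<And>j. j < p \<Longrightarrow> int p dvd m - int q - r * int q * int j \<longleftrightarrow> j = k'"
    using unique_index[OF cp] p by (metis less_le_trans zero_less_numeral)
  \<comment> \<open>Modulo \<open>q\<close> the term \<open>b * q\<close> drops out, and modulo
    \<open>p\<close> the term \<open>a * p\<close>, so divisibility by \<open>N\<close> splits into
    a condition on \<open>a\<close> and one on \<open>b\<close>.\<close>
  have n_dvd: "N dvd z - r * int (ex a b) \<longleftrightarrow>
      int q dvd z - r * int p * int a \<and> int p dvd z - r * int q * int b" if "wt a b \<noteq> 0" for z a b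
  proof -
    have "N dvd z - r * int (ex a b) \<longleftrightarrow> N dvd z - r * (int a * int p + int b * int q)"
    proof -
      have "N dvd r * (int (ex a b) - (int a * int p + int b * int q))"
        using ex_cong[OF that] unfolding N_def by (rule dvd_mult)
      then have "N dvd (z - r * (int a * int p + int b * int q)) - (z - r * int (ex a b))"
        by (simp add: algebra_simps)
      then show ?thesis by (metis dvd_diff_right_iff dvd_diff_left_iff)
    qed
    also have "\<dots> \<longleftrightarrow> int q dvd z - r * (int a * int p + int b * int q) \<and>
       int p dvd z - r * (int a * int p + int b * int q)"
      unfolding N_def using cop
      by (metis coprime_commute coprime_int_iff divides_mult dvd_mult_left dvd_mult_right of_nat_mult)
    also have "int q dvd z - r * (int a * int p + int b * int q) \<longleftrightarrow> int q dvd z - r * int p * int a"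
    proof -
      have "z - r * (int a * int p + int b * int q) = z - r * int p * int a - r * int b * int q"
        by (simp add: algebra_simps)
      then show ?thesis by (metis dvd_diff_left_iff dvd_triv_right)
    qed
    also have "int p dvd z - r * (int a * int p + int b * int q) \<longleftrightarrow> int p dvd z - r * int q * int b"
    proof -
      have "z - r * (int a * int p + int b * int q) = z - r * int q * int b - r * int a * int p"
        by (simp add: algebra_simps)
      then show ?thesis by (metis dvd_diff_left_iff dvd_triv_right)
    qed
    finally show ?thesis .
  qed
  have pick: "(\<Sum>a<q. \<Sum>b<p. W M a b * of_bool (N dvd z - r * int (ex a b))) = W M x y"
    if "x < q" "y < p" "\<And>j. j < q \<Longrightarrow> int q dvd z - r * int p * int j \<longleftrightarrow> j = x"
      "\<And>j. j < p \<Longrightarrow> int p dvd z - r * int q * int j \<longleftrightarrow> j = y" for M z x y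
  proof -
    have "(\<Sum>a<q. \<Sum>b<p. W M a b * of_bool (N dvd z - r * int (ex a b))) =
      (\<Sum>a<q. \<Sum>b<p. if b = y then if a = x then W M x y else 0 else 0)"
    proof (intro sum.cong refl)
      fix a b assume "a \<in> {..<q}" "b \<in> {..<p}"
      then show "W M a b * of_bool (N dvd z - r * int (ex a b)) =
        (if b = y then if a = x then W M x y else 0 else 0)"
        using n_dvd[of a b z] that(3)[of a] that(4)[of b]
        by (cases "wt a b = 0") (auto simp: W_def)
    qed
    also have "\<dots> = W M x y" using that(1,2) by simp
    finally show ?thesis .
  qed
  have shift: "b dvd z - b - y \<longleftrightarrow> b dvd z - y" for b z y :: int
  proof -
    have "z - y = (z - b - y) + b" by simp
    then show ?thesis by (metis dvd_add_left_iff dvd_refl)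
  qed
  \<comment> \<open>The residues 0 and \<open>q\<close> agree modulo \<open>q\<close> and select the
    same \<open>i\<close>; \<open>p\<close> and \<open>p + q\<close> share \<open>i'\<close>. Modulo
    \<open>p\<close> the pairs are 0, \<open>p\<close> and \<open>q\<close>, \<open>p + q\<close>.
    Hence the four cells are the corners of a rectangle.\<close>
  have i_q: "int q dvd m - int q - r * int p * int j \<longleftrightarrow> j = i"
    "int q dvd m - int p - int q - r * int p * int j \<longleftrightarrow> j = i'" if "j < q" for j
    using i(2) i'(2) that by (simp_all only: shift)
  have k_p: "int p dvd m - int p - r * int q * int j \<longleftrightarrow> j = k"
    "int p dvd m - int p - int q - r * int q * int j \<longleftrightarrow> j = k'" if "j < p" for j
  proof -
    have "m - int p - int q = m - int q - int p" by simp
    then show "int p dvd m - int p - r * int q * int j \<longleftrightarrow> j = k"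
      "int p dvd m - int p - int q - r * int q * int j \<longleftrightarrow> j = k'"
      using k(2) k'(2) that by (simp_all only: shift)
  qed
  have "S r M m - S r M (m - 1) = W M i k - W M i' k - W M i k' + W M i' k'" for M
  proof -
    have "S r M m - S r M (m - 1) = (\<Sum>a<q. \<Sum>b<p. W M a b *
        (chi (m - r * int (ex a b)) - chi (m - r * int (ex a b) - 1)))"
      by (simp add: S_def sum_subtractf algebra_simps)
    also have "\<dots> = (\<Sum>a<q. \<Sum>b<p. W M a b * of_bool (N dvd m - r * int (ex a b)))
      - (\<Sum>a<q. \<Sum>b<p. W M a b * of_bool (N dvd m - int p - r * int (ex a b)))
      - (\<Sum>a<q. \<Sum>b<p. W M a b * of_bool (N dvd m - int q - r * int (ex a b)))
      + (\<Sum>a<q. \<Sum>b<p. W M a b * of_bool (N dvd m - int p - int q - r * int (ex a b)))"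
      unfolding chi_step by (simp add: sum_subtractf sum.distrib algebra_simps)
    also have "\<dots> = W M i k - W M i' k - W M i k' + W M i' k'"
      using pick[OF i(1) k(1) i(2) k(2)] pick[OF i'(1) k(1) i'(2) k_p(1)]
        pick[OF i(1) k'(1) i_q(1) k'(2)] pick[OF i'(1) k'(1) i_q(2) k_p(2)] by simp
    finally show ?thesis .
  qed
  then show ?thesis using that i(1) i'(1) k(1) k'(1) by blast
qed

lemma S_step: "coprime r N \<Longrightarrow> \<bar>S r M m - S r M (m - 1)\<bar> \<le> 1"
  using W_rectangle by (metis S_step_rectangle[of r m])

text \<open>Untruncated rectangle sums vanish, so \<open>S\<close> is constant in \<open>m\<close>,
  and its sum over a period is 0 because that of \<open>chi\<close> is. This is what makes the
  series \<open>B r * K\<close> terminate.\<close>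

lemma S_total:
  assumes "coprime r N" "M \<ge> p * q"
  shows "S r M m = 0"
proof -
  have step: "S r M m = S r M (m - 1)" for m
    using W_rectangle_total[OF assms(2)] by (metis S_step_rectangle[OF assms(1), of m] eq_iff_diff_eq_0)
  have "S r M m = S r M 0" for m
    by (induction m rule: int_induct[of _ 0]) (use step in \<open>simp_all, metis add_diff_cancel_right'\<close>)
  then have "(\<Sum>m<p * q. S r M (int m)) = (\<Sum>m<p * q. S r M 0)" "S r M m = S r M 0"
    by (blast intro: sum.cong)+
  then have "(\<Sum>m<p * q. S r M (int m)) = N * S r M m"
    by (simp add: N_def)
  moreover have "(\<Sum>m<p * q. S r M (int m)) = 0"
  proof -
    have "(\<Sum>m<p * q. S r M (int m)) =
      (\<Sum>i<q. \<Sum>k<p. W M i k * (\<Sum>m<p * q. chi (int m - r * int (ex i k))))"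
      unfolding S_def sum_distrib_left
      by (subst sum.swap, rule sum.cong[OF refl], subst sum.swap) simp
    also have "\<dots> = 0" using sum_chi[of "- _"] by simp
    finally show ?thesis .
  qed
  ultimately show ?thesis using N_pos by simp
qed


section \<open>Power series for Q(x^r) and 1 / Q(x)\<close>

definition B :: "nat \<Rightarrow> int fps" where
  "B r = (\<Sum>i<q. \<Sum>k<p. of_int (wt i k) * (fps_X ^ r) ^ ex i k)"

lemma B_mult: "B r * ((1 - fps_X ^ (p * r)) * (1 - fps_X ^ (q * r))) =
    (1 - fps_X ^ r) * (1 - fps_X ^ (p * q * r))"
proof -
  have "(fps_X ^ r) ^ a = (fps_X ^ (a * r) :: int fps)" for a
    by (simp add: mult.commute flip: power_mult)
  then show ?thesis using grid_product[of "fps_X ^ r :: int fps"] unfolding B_def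
    by (simp only:)
qed

text \<open>Multiplication by \<open>geo 1\<close> forms partial sums, and Q(x) / (1 - x) = (1 + x^p
  + ... + x^((q - 1) p)) / (1 - x^q). The coefficient at \<open>j\<close> counts the
  \<open>i < q\<close> with \<open>i * p \<le> j\<close> and \<open>i * p\<close> congruent to
  \<open>j\<close> modulo \<open>q\<close>; coprimality allows at most one.\<close>

lemma psum_in_01: "psum M \<in> {0, 1}"
proof (cases M)
  case 0
  then show ?thesis by (simp add: psum_def)
next
  case (Suc j)
  define L :: "int fps" where "L = (\<Sum>i<q. fps_X ^ (i * p))"
  have L: "L * (1 - fps_X ^ p) = 1 - fps_X ^ (p * q)"
    unfolding L_def sum_power_mult by (simp only: mult.commute)
  have "B 1 * geo 1 = B 1 * geo 1 * ((1 - fps_X ^ p) * geo p) * ((1 - fps_X ^ q) * geo q)"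
    using geo_mult[of p] geo_mult[of q] p q by simp
  also have "\<dots> = (B 1 * ((1 - fps_X ^ p) * (1 - fps_X ^ q))) * (geo 1 * geo p * geo q)"
    by (simp only: ac_simps)
  also have "\<dots> = ((1 - fps_X ^ 1) * geo 1) * (1 - fps_X ^ (p * q)) * geo p * geo q"
    using B_mult[of 1] by (simp add: ac_simps)
  also have "\<dots> = L * ((1 - fps_X ^ p) * geo p) * geo q"
    unfolding L[symmetric] using geo_mult[of 1] by (simp add: mult.assoc)
  also have "\<dots> = L * geo q"
    using geo_mult[of p] p by simp
  finally have eq: "B 1 * geo 1 = L * geo q" .
  have "psum M = (B 1 * geo 1) $ j"
  proof -
    have "(of_int (wt i k) * fps_X ^ ex i k * geo 1) $ j = W M i k" for i k
      by (simp add: fps_of_int[symmetric] mult.assoc fps_X_power_mult_nth geo_def W_def Suc less_Suc_eq_le not_less)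
    then show ?thesis
      by (simp add: psum_def B_def sum_distrib_right fps_sum_nth)
  qed
  also have "\<dots> = (\<Sum>i<q. of_bool (i * p \<le> j \<and> q dvd j - i * p))"
    unfolding eq L_def sum_distrib_right fps_sum_nth
    by (rule sum.cong) (auto simp: fps_X_power_mult_nth geo_def)
  also have "\<dots> = int (card {i. i < q \<and> i * p \<le> j \<and> q dvd j - i * p})"
    by (simp add: of_bool_def sum.If_cases Collect_conj_eq lessThan_def Int_assoc)
  finally have "psum M = int (card {i. i < q \<and> i * p \<le> j \<and> q dvd j - i * p})" .
  moreover have "card {i. i < q \<and> i * p \<le> j \<and> q dvd j - i * p} \<le> 1"
  proof -
    have "i = i'" if "i < q" "i' < q" "i * p \<le> j" "i' * p \<le> j" "q dvd j - i * p" "q dvd j - i' * p" for i i'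
    proof -
      have "[i * p = i' * p] (mod q)"
      proof -
        have "[j = i * p] (mod q)" "[j = i' * p] (mod q)"
          using that(3-6) by (simp_all add: cong_altdef_nat)
        then show ?thesis by (metis cong_sym cong_trans)
      qed
      then have "[i = i'] (mod q)"
        using cop by (simp add: cong_mult_rcancel_nat coprime_commute)
      then show ?thesis using that(1,2) by (simp add: cong_def)
    qed
    then show ?thesis by (auto simp: card_le_Suc0_iff_eq)
  qed
  ultimately show ?thesis by (simp only: insert_iff empty_iff) linarith
qed

text \<open>The power series \<open>1 / Q\<close>.\<close>

definition K :: "int fps" where
  "K = Abs_fps (\<lambda>j. chi (int j))"

text \<open>By \<open>chi_step\<close> the differences of \<open>chi\<close> are the coefficients of
  (1 - x^p)(1 - x^q) / (1 - x^(pq)); \<open>chi (- 1) = 0\<close> settles the constant term.\<close>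

lemma K_mult: "K * ((1 - fps_X) * (1 - fps_X ^ (p * q))) = (1 - fps_X ^ p) * (1 - fps_X ^ q)"
proof -
  have "(1 - fps_X) * K = (1 - fps_X ^ p) * (1 - fps_X ^ q) * geo (p * q)"
  proof (rule fps_ext)
    fix j
    have shift: "(fps_X ^ a * geo (p * q)) $ j = of_bool (N dvd int j - int a)" if "int a < N" for a
    proof (cases "j < a")
      case True
      then have "\<not> N dvd int a - int j" using that by (auto dest: zdvd_imp_le)
      then have "\<not> N dvd int j - int a" by (simp add: dvd_diff_commute)
      then show ?thesis using True by (simp add: fps_X_power_mult_nth)
    next
      case False
      then have "int j - int a = int (j - a)" by simp
      then show ?thesis using False
        by (simp add: fps_X_power_mult_nth geo_def N_def del: of_nat_diff of_nat_mult)
    qed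
    have "((1 - fps_X) * K) $ j = chi (int j) - chi (int j - 1)"
      using chi_minus_one by (cases j) (simp_all add: algebra_simps K_def)
    also have "\<dots> = (geo (p * q) - fps_X ^ p * geo (p * q) - fps_X ^ q * geo (p * q)
        + fps_X ^ (p + q) * geo (p * q)) $ j"
      using shift[of 0] shift[of p] shift[of q] shift[of "p + q"] N_gt
      by (simp add: chi_step diff_diff_eq)
    also have "geo (p * q) - fps_X ^ p * geo (p * q) - fps_X ^ q * geo (p * q)
        + fps_X ^ (p + q) * geo (p * q) = (1 - fps_X ^ p) * (1 - fps_X ^ q) * geo (p * q)"
      by (simp add: algebra_simps power_add)
    finally show "((1 - fps_X) * K) $ j = ((1 - fps_X ^ p) * (1 - fps_X ^ q) * geo (p * q)) $ j" .
  qed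
  then have "K * ((1 - fps_X) * (1 - fps_X ^ (p * q))) =
      (1 - fps_X ^ p) * (1 - fps_X ^ q) * ((1 - fps_X ^ (p * q)) * geo (p * q))"
    by (simp add: ac_simps)
  then show ?thesis using geo_mult[of "p * q"] p q by simp
qed

lemma BK_nth: "r > 0 \<Longrightarrow> (B r * K) $ j = S (int r) (j div r + 1) (int j)"
proof -
  assume r: "r > 0"
  have "(of_int (wt i k) * (fps_X ^ r) ^ ex i k * K) $ j =
      W (j div r + 1) i k * chi (int j - int r * int (ex i k))" for i k
  proof -
    \<comment> \<open>Exponent \<open>e\<close> of \<open>Q\<close> contributes exactly if
      \<open>r * e \<le> j\<close>, whence the truncation at \<open>j div r + 1\<close>.\<close>
    have "j < r * ex i k \<longleftrightarrow> \<not> ex i k < j div r + 1"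
      using r by (simp add: div_less_iff_less_mult mult.commute less_Suc_eq_le not_le)
    then have "(fps_X ^ (r * ex i k) * K) $ j =
        of_bool (ex i k < j div r + 1) * chi (int j - int r * int (ex i k))"
      by (cases "j < r * ex i k") (simp_all add: fps_X_power_mult_nth K_def of_nat_diff)
    then show ?thesis
      by (simp add: W_def mult.assoc flip: power_mult fps_of_int)
  qed
  then show ?thesis
    by (simp add: B_def S_def sum_distrib_right fps_sum_nth)
qed

section \<open>The ternary polynomial and its coefficients\<close>

text \<open>For \<open>r > 0\<close> coprime to \<open>p * q\<close> the cut loses nothing: from
  exponent \<open>p * q * r\<close> on, the coefficients of the series vanish by
  \<open>S_total\<close>.\<close>

definition ternary :: "nat \<Rightarrow> int poly" where
  "ternary r = truncate_fps (p * q * r) (B r * K)"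

lemma coeff_ternary:
  assumes "r > 0" "coprime (p * q) r"
  shows "coeff (ternary r) j = S (int r) (j div r + 1) (int j)"
proof (cases "j < p * q * r")
  case True
  then show ?thesis using BK_nth[OF assms(1)] by (simp add: ternary_def)
next
  case False
  then have "p * q \<le> j div r + 1"
    using assms(1) by (metis div_le_mono le_add1 le_trans nonzero_mult_div_cancel_right not_less not_gr_zero)
  moreover have "coprime (int r) N" unfolding N_def using assms(2) by (simp only: coprime_int_iff coprime_commute)
  ultimately show ?thesis using False S_total by (simp add: ternary_def)
qed

lemma ternary_mult:
  assumes "r > 0" "coprime (p * q) r"
  shows "ternary r * ((monom 1 1 - 1) * (monom 1 (p * q) - 1) * (monom 1 (p * r) - 1) * (monom 1 (q * r) - 1))
      = (monom 1 p - 1) * (monom 1 q - 1) * (monom 1 r - 1) * (monom 1 (p * q * r) - 1)"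
proof -
  have "fps_of_poly (ternary r) = B r * K"
    by (rule fps_ext) (simp add: coeff_ternary[OF assms] BK_nth[OF assms(1)])
  then have "fps_of_poly (ternary r) * ((fps_X - 1) * (fps_X ^ (p * q) - 1) * (fps_X ^ (p * r) - 1) * (fps_X ^ (q * r) - 1))
    = (K * ((1 - fps_X) * (1 - fps_X ^ (p * q)))) * (B r * ((1 - fps_X ^ (p * r)) * (1 - fps_X ^ (q * r))))"
    by (simp add: algebra_simps)
  also have "\<dots> = (fps_X ^ p - 1) * (fps_X ^ q - 1) * (fps_X ^ r - 1) * (fps_X ^ (p * q * r) - 1)"
    unfolding K_mult B_mult by (simp add: algebra_simps)
  finally show ?thesis
    by (subst fps_of_poly_eq_iff[symmetric])
       (simp only: fps_of_poly_mult fps_of_poly_diff fps_of_poly_monom' fps_of_poly_1 power_one_right)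
qed

lemma unitary_cyclotomic_eq_ternary:
  assumes "primepow p" "primepow q" "primepow r" "coprime p r" "coprime q r"
  shows "unitary_cyclotomic (p * q * r) = ternary r"
proof (rule unitary_cyclotomic_ternary_eqI)
  have "r > 0" "coprime (p * q) r" using assms primepow_gt_0_nat by simp_all
  then show "ternary r * ((monom 1 1 - 1) * (monom 1 (p * q) - 1) * (monom 1 (p * r) - 1) * (monom 1 (q * r) - 1))
      = (monom 1 p - 1) * (monom 1 q - 1) * (monom 1 r - 1) * (monom 1 (p * q * r) - 1)"
    by (rule ternary_mult)
qed (use assms cop in simp_all)

section \<open>Consecutive coefficients\<close>

lemma unit_coeff_step:
  assumes "r > 0" "coprime (p * q) r"
  shows "\<bar>coeff (ternary r) (Suc j) - coeff (ternary r) j\<bar> \<le> 1"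
proof -
  \<comment> \<open>If \<open>r\<close> divides \<open>Suc j\<close>, the truncation index grows by
    one, but the new summand at \<open>j\<close> carries the factor \<open>chi (- 1) = 0\<close>. So
    both coefficients can be compared at the same truncation.\<close>
  have "S (int r) (j div r + 1) (int j) = S (int r) (Suc j div r + 1) (int j)"
  proof (cases "Suc j mod r = 0")
    case True
    then have *: "Suc j div r = Suc (j div r)" by (simp add: div_Suc)
    then have "r * Suc (j div r) = Suc j" using True by (metis mult_div_mod_eq add_0_right)
    then have "int r * int (Suc (j div r)) = int j + 1" by (metis of_nat_Suc of_nat_mult add.commute)
    then have "int j - int r * int (Suc (j div r)) = - 1" by linarith
    then show ?thesis using S_Suc[of "int r" "Suc (j div r)" "int j"] * by simp
  next
    case False
    then show ?thesis by (simp add: div_Suc)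
  qed
  moreover have "coprime (int r) N"
    unfolding N_def using assms(2) by (simp only: coprime_int_iff coprime_commute)
  ultimately show ?thesis
    using S_step[of "int r" "Suc j div r + 1" "int (Suc j)"] coeff_ternary[OF assms] by simp
qed

lemma coeffs_interval:
  assumes "r > 0" "coprime (p * q) r"
  shows "\<exists>a b. range (coeff (ternary r)) = {a..b}"
proof (rule interval_of_unit_steps)
  have "range (coeff (ternary r)) \<subseteq> insert 0 (coeff (ternary r) ` {..degree (ternary r)})"
  proof
    fix x assume "x \<in> range (coeff (ternary r))"
    then obtain j where "x = coeff (ternary r) j" by blast
    then show "x \<in> insert 0 (coeff (ternary r) ` {..degree (ternary r)})"
      by (cases "j \<le> degree (ternary r)") (auto simp: coeff_eq_0)
  qed
  then show "finite (range (coeff (ternary r)))" using finite_subset by blast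
qed (rule unit_coeff_step[OF assms])

lemma zero_in_coeffs: "0 \<in> range (coeff (ternary r))"
  by (metis coeff_eq_0 lessI rangeI)

text \<open>
  The argument of \<open>\<chi>\<close> in the last summand of \<open>S r M m\<close>, the one with index \<open>M - 1\<close>.
\<close>

definition pos :: "int \<Rightarrow> int \<Rightarrow> nat \<Rightarrow> int" where
  "pos r m M = (m - r * (int M - 1)) mod N"

lemma pos_bounds [simp]: "0 \<le> pos r m M" "pos r m M < N"
  by (simp_all add: pos_def)

lemma pos_forward: "pos r m (Suc M) = pos r m M - r" if "r \<le> pos r m M" "0 \<le> r"
proof -
  have "pos r m (Suc M) = (pos r m M - r) mod N"
    by (simp add: pos_def mod_diff_left_eq algebra_simps)
  also have "\<dots> = pos r m M - r"
    using that pos_bounds(2)[of r m M] by (intro mod_pos_pos_trivial) linarith+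
  finally show ?thesis .
qed

text \<open>Going back adds \<open>r\<close>; a wrap-around modulo \<open>N\<close> lands below
  \<open>r\<close>.\<close>

lemma pos_backward: "pos r m M = pos r m (Suc M) + r \<or> pos r m M < r" if "r \<le> pos r m (Suc M)" "0 \<le> r"
proof -
  define t where "t = pos r m (Suc M)"
  have t: "0 \<le> t" "t < N" by (simp_all add: t_def)
  have eq: "pos r m M = (t + r) mod N"
    unfolding t_def pos_def mod_add_left_eq by (simp add: algebra_simps)
  show ?thesis
  proof (cases "t + r < N")
    case True
    then have "(t + r) mod N = t + r" using t that by (intro mod_pos_pos_trivial) linarith+
    then show ?thesis by (simp add: eq t_def)
  next
    case False
    have "(t + r) mod N = (t + r - N) mod N" by simp
    also have "\<dots> = t + r - N" using False t that[folded t_def] by (intro mod_pos_pos_trivial) linarith+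
    finally show ?thesis using t by (simp add: eq)
  qed
qed

section \<open>Values of \<open>S\<close> that are coefficients\<close>

lemma S_Suc_pos: "S r (Suc M) m = S r M m + (psum (Suc M) - psum M) *
   (of_bool (pos r m (Suc M) < int p) - of_bool (int q \<le> pos r m (Suc M) \<and> pos r m (Suc M) < int p + int q))"
  using chi_eq[of "pos r m (Suc M)"] S_Suc[of r M m] by (simp add: pos_def)

lemma coeff_eq_S_Suc:
  assumes "r > 0" "coprime (p * q) r" "pos (int r) m (Suc M) < int r"
  shows "S (int r) (Suc M) m \<in> range (coeff (ternary r))"
proof -
  \<comment> \<open>The exponent \<open>r * M + t\<close> is congruent to \<open>m\<close> modulo
    \<open>N\<close> and has quotient \<open>M\<close> by \<open>r\<close>.\<close>
  define t where "t = nat (pos (int r) m (Suc M))"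
  have t: "int t = pos (int r) m (Suc M)" by (simp add: t_def)
  then have "t < r" using assms(3) by linarith
  then have "(r * M + t) div r = M" by simp
  moreover have "S (int r) (Suc M) (int (r * M + t)) = S (int r) (Suc M) m"
  proof (rule S_cong)
    have "int (r * M + t) mod N = m mod N"
      by (simp add: t pos_def mod_add_right_eq)
    then show "N dvd int (r * M + t) - m" by (simp only: mod_eq_dvd_iff)
  qed simp
  ultimately show ?thesis
    by (metis Suc_eq_plus1 assms(1,2) coeff_ternary rangeI)
qed

text \<open>Going back from a position \<open>t\<close> with \<open>r \<le> t\<close> and
  \<open>p + q \<le> t\<close> leads to \<open>t + r\<close> or below \<open>r\<close>, so the
  condition survives dropping the vanishing summand. The descent ends at a coefficient or at the
  empty sum.\<close>

lemma S_in_coeffs: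
  assumes "r > 0" "coprime (p * q) r"
    and "pos (int r) m M < int r \<or> int p + int q \<le> pos (int r) m M"
  shows "S (int r) M m \<in> range (coeff (ternary r))"
  using assms(3)
proof (induction M)
  case 0
  then show ?case using zero_in_coeffs by simp
next
  case (Suc M)
  show ?case
  proof (cases "pos (int r) m (Suc M) < int r")
    case True
    then show ?thesis by (rule coeff_eq_S_Suc[OF assms(1,2)])
  next
    case False
    with Suc.prems have t: "int p + int q \<le> pos (int r) m (Suc M)" by simp
    then have "S (int r) (Suc M) m = S (int r) M m"
      unfolding S_Suc_pos by simp
    moreover have "pos (int r) m M < int r \<or> int p + int q \<le> pos (int r) m M"
      using pos_backward[of "int r" m M] False t by linarith
    ultimately show ?thesis using Suc.IH by simp
  qed
qed

lemma coeffs_subset: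
  assumes "r > 0" "coprime (p * q) r"
  shows "range (coeff (ternary r)) \<subseteq> (\<Union>M. range (S (int r) M))"
  using coeff_ternary[OF assms] by auto

text \<open>The right-hand side depends on \<open>r\<close> only modulo \<open>p * q\<close>, which
  allows comparing \<open>r\<close> with \<open>s\<close>.\<close>

lemma coeffs_eq_range_S:
  assumes "coprime (p * q) r" "r > max p q"
  shows "range (coeff (ternary r)) = (\<Union>M. range (S (int r) M))"
proof (intro equalityI subsetI)
  have r: "r > 0" using assms(2) by simp
  fix x
  show "x \<in> (\<Union>M. range (S (int r) M))" if "x \<in> range (coeff (ternary r))"
    using that coeffs_subset[OF r assms(1)] by blast
  assume "x \<in> (\<Union>M. range (S (int r) M))"
  then obtain M m where x: "x = S (int r) M m" by auto
  let ?t = "pos (int r) m M"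
  show "x \<in> range (coeff (ternary r))"
  proof (cases "M = 0 \<or> ?t < int r \<or> int p + int q \<le> ?t")
    case True
    then show ?thesis using S_in_coeffs[OF r assms(1)] zero_in_coeffs x by auto
  next
    case False
    then obtain M' where M': "M = Suc M'" by (cases M) auto
    have t: "int r \<le> ?t" "?t < int p + int q" using False by simp_all
    \<comment> \<open>As \<open>r > max p q\<close>, one step in either direction leaves the window:
      back to at least \<open>p + q\<close> or below \<open>r\<close>, forward to
      \<open>?t - r < min p q < r\<close>.\<close>
    have "int p + int q \<le> ?t + int r" using t assms(2) by linarith
    then have "S (int r) M' m \<in> range (coeff (ternary r))"
      using pos_backward[of "int r" m M'] t by (intro S_in_coeffs[OF r assms(1)]) (auto simp: M')
    moreover have fwd: "pos (int r) m (Suc M) = ?t - int r"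
      using pos_forward t(1) by simp
    then have "S (int r) (Suc M) m \<in> range (coeff (ternary r))"
      using t assms(2) by (intro S_in_coeffs[OF r assms(1)]) linarith
    \<comment> \<open>\<open>chi\<close> is -1 at \<open>?t\<close> and 1 at \<open>?t - r\<close>.
      If \<open>psum M = 0\<close>, the values of \<open>S\<close> at \<open>M'\<close>,
      \<open>M\<close>, \<open>Suc M\<close> are weakly increasing; if \<open>psum M = 1\<close>,
      weakly decreasing. So the middle one lies in the interval of coefficients.\<close>
    moreover have "S (int r) M m = S (int r) M' m - (psum M - psum M')"
      unfolding M' S_Suc_pos using t assms(2) by (simp add: M')
    moreover have "S (int r) (Suc M) m = S (int r) M m + (psum (Suc M) - psum M)"
      unfolding S_Suc_pos fwd using t assms(2) by simp
    moreover obtain a b where "range (coeff (ternary r)) = {a..b}"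
      using coeffs_interval[OF r assms(1)] by blast
    ultimately show ?thesis
      using psum_in_01[of M] psum_in_01[of M'] psum_in_01[of "Suc M"] unfolding x by auto
  qed
qed

text \<open>For small \<open>r\<close> several steps may be needed to leave the window; as
  \<open>chi\<close> is constant on each stretch, their contributions telescope to a difference of
  two values of \<open>psum\<close>.\<close>

lemma S_near_coeffs:
  assumes "r > 0" "coprime (p * q) r" "p < q"
  shows "\<exists>g\<in>range (coeff (ternary r)). \<bar>S (int r) M m - g\<bar> \<le> 1"
proof -
  let ?G = "range (coeff (ternary r))"
  \<comment> \<open>From positions at least \<open>p\<close> the path goes back. On [q, p + q)
    \<open>chi\<close> is -1 and the sum telescopes; on [p, q) nothing changes. The clause
    \<open>k' = M\<close> says that the telescoping sum is still open.\<close>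
  have upper: "\<exists>g\<in>?G. \<exists>k k'. S (int r) M m = g + psum k - psum k' \<and> (int q \<le> pos (int r) m M \<longrightarrow> k' = M)"
    if "int p \<le> pos (int r) m M" for M
    using that
  proof (induction M)
    case 0
    then show ?case using zero_in_coeffs by (metis S_0 add_0 diff_self)
  next
    case (Suc M)
    let ?t = "pos (int r) m (Suc M)"
    show ?case
    proof (cases "?t < int r \<or> int p + int q \<le> ?t")
      case True
      then have "S (int r) (Suc M) m \<in> ?G" by (rule S_in_coeffs[OF assms(1,2)])
      then show ?thesis by (metis add_diff_cancel_right')
    next
      case False
      have prev: "pos (int r) m M = ?t + int r \<or> pos (int r) m M < int r"
        using pos_backward[of "int r" m M] False by simp
      have IH: "\<exists>g\<in>?G. \<exists>k k'. S (int r) M m = g + psum k - psum k' \<and> (int q \<le> ?t \<longrightarrow> k' = M)"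
      proof (cases "pos (int r) m M < int r")
        case True
        then have "S (int r) M m \<in> ?G" by (intro S_in_coeffs[OF assms(1,2)]) simp
        then show ?thesis by (metis add_diff_cancel_right')
      next
        case False
        then have "pos (int r) m M = ?t + int r" using prev by simp
        then show ?thesis using Suc.IH Suc.prems by fastforce
      qed
      show ?thesis
      proof (cases "int q \<le> ?t")
        case True
        then have "S (int r) (Suc M) m = S (int r) M m - (psum (Suc M) - psum M)"
          unfolding S_Suc_pos using False Suc.prems by simp
        then show ?thesis using IH True by force
      next
        case low: False
        then have "S (int r) (Suc M) m = S (int r) M m"
          unfolding S_Suc_pos using Suc.prems by simp
        then show ?thesis using IH low by auto
      qed
    qed
  qed
  \<comment> \<open>Below \<open>p\<close> the path goes forward: positions fall by \<open>r\<close>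
    and \<open>chi\<close> is 1 until a position below \<open>r\<close> is reached.\<close>
  have lower: "\<exists>g\<in>?G. \<exists>k. S (int r) M m = g - psum k + psum M" if "pos (int r) m M < int p" for M
    using that
  proof (induction "nat (pos (int r) m M)" arbitrary: M rule: less_induct)
    case less
    show ?case
    proof (cases "pos (int r) m M < int r")
      case True
      then have "S (int r) M m \<in> ?G" by (intro S_in_coeffs[OF assms(1,2)]) simp
      then show ?thesis by (metis diff_add_cancel)
    next
      case False
      then have fwd: "pos (int r) m (Suc M) = pos (int r) m M - int r"
        by (intro pos_forward) simp_all
      have "nat (pos (int r) m (Suc M)) < nat (pos (int r) m M)"
        using fwd assms(1) False by linarith
      moreover have "pos (int r) m (Suc M) < int p" using fwd less.prems by linarith
      ultimately obtain g k where "g \<in> ?G" "S (int r) (Suc M) m = g - psum k + psum (Suc M)"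
        using less.hyps by blast
      moreover have "S (int r) (Suc M) m = S (int r) M m + (psum (Suc M) - psum M)"
        unfolding S_Suc_pos fwd using less.prems assms(3) by simp
      ultimately have "S (int r) M m = g - psum k + psum M" by simp
      then show ?thesis using \<open>g \<in> ?G\<close> by blast
    qed
  qed
  have diff: "\<bar>psum k - psum k'\<bar> \<le> 1" for k k'
    using psum_in_01[of k] psum_in_01[of k'] by auto
  show ?thesis
  proof (cases "pos (int r) m M < int p")
    case True
    then obtain g k where "g \<in> ?G" "S (int r) M m = g - psum k + psum M"
      using lower[of M] by blast
    then show ?thesis using diff[of M k] by (intro bexI[of _ g]) simp_all
  next
    case False
    then obtain g k k' where "g \<in> ?G" "S (int r) M m = g + psum k - psum k'"
      using upper[of M] by (meson not_less)
    then show ?thesis using diff[of k k'] by (intro bexI[of _ g]) simp_all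
  qed
qed

lemma range_S_cong: "(\<Union>M. range (S r M)) = (\<Union>M. range (S s M))" if "N dvd r - s"
proof -
  have "S r M = S s M" for M using S_cong[OF that] by force
  then show ?thesis by simp
qed

lemma range_S_uminus: "(\<Union>M. range (S (- r) M)) = uminus ` (\<Union>M. range (S r M))"
proof -
  have "range (S (- r) M) = uminus ` range (S r M)" for M
  proof -
    let ?c = "int p + int q - 1"
    have "range (S (- r) M) = (\<lambda>m. - S r M m) ` range (\<lambda>m. ?c - m)"
      unfolding image_image by (rule image_cong) (simp_all add: S_uminus)
    also have "range (\<lambda>m. ?c - m) = UNIV" by (rule surjI[of _ "\<lambda>m. ?c - m"]) simp
    finally show ?thesis by (simp only: image_image)
  qed
  then show ?thesis by (simp add: image_UN)
qed

section \<open>The coefficient 0 within the degree\<close>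

lemma degree_ternary:
  assumes "r > 0" "coprime (p * q) r"
  shows "degree (ternary r) + (1 + p * q + p * r + q * r) = p + q + r + p * q * r"
proof -
  have monom: "degree (monom 1 d - 1 :: int poly) = d" "monom 1 d - 1 \<noteq> (0 :: int poly)" if "d > 0" for d
  proof -
    have c: "coeff (monom 1 d - 1 :: int poly) d = 1" using that by simp
    have "degree (monom 1 d - 1 :: int poly) \<le> d"
      by (rule degree_diff_le) (simp_all add: degree_monom_eq)
    with c show "degree (monom 1 d - 1 :: int poly) = d"
      by (metis le_antisym le_degree zero_neq_one)
    from c show "monom 1 d - 1 \<noteq> (0 :: int poly)" by (metis coeff_0 zero_neq_one)
  qed
  note eq = ternary_mult[OF assms]
  have pos: "p > 0" "q > 0" using p q by simp_all
  have "ternary r \<noteq> 0"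
    using arg_cong[OF eq, of "\<lambda>f. f = 0"] monom(2) pos assms(1) by auto
  then show ?thesis
    using arg_cong[OF eq, of degree] monom pos assms(1) by (simp add: degree_mult_eq)
qed

text \<open>The exponent is \<open>p\<close>: as \<open>p < r\<close>, only the constant term of
  \<open>Q\<close> enters, with factor \<open>chi p = 0\<close>. The degree (p - 1)(q - 1)(r - 1) is
  at least \<open>p\<close>.\<close>

lemma zero_in_coeff_set_ternary:
  assumes "3 \<le> p" "p < q" "p < r" "coprime (p * q) r"
  shows "0 \<in> coeff_set (ternary r)"
proof -
  have r: "r > 0" using assms by simp
  have "p \<le> degree (ternary r)"
  proof -
    obtain a b c where "p = a + 3" "q = b + 3" "r = c + 3"
      using assms by (metis add.commute le_add_diff_inverse le_trans less_imp_le)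
    then have "1 + p * q + p * r + q * r + p \<le> p + q + r + p * q * r"
      by (simp add: algebra_simps)
    then show ?thesis using degree_ternary[OF r assms(4)] by linarith
  qed
  moreover have "coeff (ternary r) p = 0"
  proof -
    have "chi (int p) = 0" using assms(2) N_gt by (simp add: chi_eq)
    then show ?thesis
      using coeff_ternary[OF r assms(4), of p] S_Suc[of "int r" 0 "int p"] assms(3) by simp
  qed
  ultimately show ?thesis unfolding coeff_set_def by force
qed

end

lemma binary_grid_exists:
  fixes p q :: nat
  assumes "p \<ge> 2" "q \<ge> 2" "coprime p q"
  shows "\<exists>u v. binary_grid p q u v"
proof -
  obtain x where x: "[p * x = 1] (mod q)"
    using cong_solve_coprime_nat[OF assms(3)] by auto
  define u where "u = x mod q"
  have u: "u < q" using assms by (simp add: u_def)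
  have "[p * u = 1] (mod q)" using x by (simp add: u_def cong_def mod_mult_right_eq)
  then have pu: "(p * u) mod q = 1" using assms(2) by (simp add: cong_def)
  have le: "p * u + p \<le> p * q" using mult_le_mono2[of "Suc u" q p] u by simp
  have "(p * q + 1) mod q = (p * u) mod q"
    unfolding mod_mult_self3 using pu assms(2) by simp
  then have "q dvd p * q + 1 - p * u" using le by (simp add: mod_eq_dvd_iff_nat)
  then obtain v where v: "p * q + 1 - p * u = q * v" by blast
  then have uv: "u * p + v * q = p * q + 1" using le by (simp add: mult.commute)
  moreover have "v \<le> p"
  proof (cases "u = 0")
    case True
    then show ?thesis using pu by simp
  next
    case False
    then have "p \<le> u * p" by simp
    then have "v * q \<le> p * q" using uv assms(1) by linarith
    then show ?thesis using assms(2) by simp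
  qed
  ultimately have "binary_grid p q u v"
    using assms u by unfold_locales simp_all
  then show ?thesis by blast
qed

text \<open>By symmetry the least of the three can be put first. Hence \<open>coeff_set\<close>
  agrees with the range of \<open>coeff\<close>, which always contains 0.\<close>

lemma zero_in_coeff_set:
  fixes p q r :: nat
  assumes "primepow p" "primepow q" "primepow r" "p \<ge> 3" "q \<ge> 3" "r \<ge> 3"
    and "coprime p q" "coprime p r" "coprime q r"
  shows "0 \<in> coeff_set (unitary_cyclotomic (p * q * r))"
proof -
  have least: "0 \<in> coeff_set (unitary_cyclotomic (a * b * c))"
    if abc: "primepow a" "primepow b" "primepow c" "a \<ge> 3" "b \<ge> 3"
      "coprime a b" "coprime a c" "coprime b c" "a < b" "a < c" for a b c :: nat
  proof -
    obtain u v where "binary_grid a b u v"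
      using binary_grid_exists[of a b] abc by auto
    then interpret binary_grid a b u v .
    show ?thesis
      using abc zero_in_coeff_set_ternary[of c] by (simp add: unitary_cyclotomic_eq_ternary)
  qed
  have "p \<noteq> q" "p \<noteq> r" "q \<noteq> r" using assms by auto
  then consider "p < q" "p < r" | "q < p" "q < r" | "r < p" "r < q" by linarith
  then show ?thesis
  proof cases
    case 1
    then show ?thesis using assms by (intro least) simp_all
  next
    case 2
    then show ?thesis using least[of q p r] assms by (simp add: ac_simps)
  next
    case 3
    then show ?thesis using least[of r p q] assms by (simp add: ac_simps)
  qed
qed

lemma coeff_set_eq_range:
  assumes "0 \<in> coeff_set f"
  shows "coeff_set f = range (coeff f)"
proof (intro equalityI subsetI)
  fix x assume "x \<in> range (coeff f)"
  then obtain j where "x = coeff f j" by blast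
  then show "x \<in> coeff_set f"
    using assms coeff_eq_0[of f j] unfolding coeff_set_def by (cases "j \<le> degree f") auto
qed (auto simp: coeff_set_def)

section \<open>Comparison of heights\<close>

lemma finite_coeff_set: "finite (coeff_set f)"
  unfolding coeff_set_def by simp

lemma height_le_height_add:
  assumes "\<And>c. c \<in> coeff_set f \<Longrightarrow> \<exists>d\<in>coeff_set g. \<bar>c\<bar> \<le> \<bar>d\<bar> + k"
  shows "height f \<le> height g + k"
proof -
  have fin: "finite {\<bar>c\<bar> |c. c \<in> coeff_set h}" for h using finite_coeff_set[of h] by simp
  have "coeff f 0 \<in> coeff_set f" unfolding coeff_set_def by blast
  then have "height f \<in> {\<bar>c\<bar> |c. c \<in> coeff_set f}"
    unfolding height_def using fin by (intro Max_in) blast+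
  then obtain c where c: "c \<in> coeff_set f" "height f = \<bar>c\<bar>" by blast
  then obtain d where d: "d \<in> coeff_set g" "\<bar>c\<bar> \<le> \<bar>d\<bar> + k" using assms by blast
  then have "\<bar>d\<bar> \<le> height g" unfolding height_def using fin by (intro Max_ge) blast+
  then show ?thesis using c d by linarith
qed

text \<open>The coefficients for \<open>r\<close> are all values of \<open>S\<close>, up to sign
  also those for \<open>s\<close>. The coefficients for \<open>s\<close> are among them, and each
  value is within 1 of such a coefficient.\<close>

lemma height_bounds:
  fixes p q r s :: nat
  assumes pp: "primepow p" "primepow q" "primepow r" "primepow s"
    and ge: "p \<ge> 3" "q \<ge> 3" "r \<ge> 3" "s \<ge> 3"
    and cop: "coprime p q" "coprime p r" "coprime p s" "coprime q r" "coprime q s"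
    and rs: "[int r = int s] (mod int (p * q)) \<or> [int r = - int s] (mod int (p * q))"
    and r: "r > max p q" and pq: "p < q"
  shows "height (unitary_cyclotomic (p * q * s)) \<le> height (unitary_cyclotomic (p * q * r))"
    and "height (unitary_cyclotomic (p * q * r)) \<le> height (unitary_cyclotomic (p * q * s)) + 1"
proof -
  obtain u v where "binary_grid p q u v"
    using binary_grid_exists[of p q] assms by auto
  then interpret binary_grid p q u v .
  have Cr: "coeff_set (unitary_cyclotomic (p * q * r)) = range (coeff (ternary r))"
    using zero_in_coeff_set[of p q r] coeff_set_eq_range[of "ternary r"] assms
    by (simp add: unitary_cyclotomic_eq_ternary)
  have Cs: "coeff_set (unitary_cyclotomic (p * q * s)) = range (coeff (ternary s))"
    using zero_in_coeff_set[of p q s] coeff_set_eq_range[of "ternary s"] assms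
    by (simp add: unitary_cyclotomic_eq_ternary)
  have s: "s > 0" "coprime (p * q) s" using assms by simp_all
  let ?S = "\<lambda>r. \<Union>M. range (S r M)"
  have Fr: "range (coeff (ternary r)) = ?S (int r)"
    using assms by (intro coeffs_eq_range_S) simp_all
  have "N dvd int r - int s \<or> N dvd int r - - int s"
    using rs unfolding cong_iff_dvd_diff N_def .
  then have "?S (int r) = ?S (int s) \<or> ?S (int r) = ?S (- int s)"
    by (metis range_S_cong)
  then have F: "?S (int r) = ?S (int s) \<or> ?S (int r) = uminus ` ?S (int s)"
    by (simp only: range_S_uminus)
  show "height (unitary_cyclotomic (p * q * s)) \<le> height (unitary_cyclotomic (p * q * r))"
  proof -
    have "\<exists>d\<in>range (coeff (ternary r)). \<bar>c\<bar> \<le> \<bar>d\<bar> + 0" if "c \<in> range (coeff (ternary s))" for c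
    proof -
      have "c \<in> ?S (int s)" using coeffs_subset[OF s] that by blast
      then have "c \<in> ?S (int r) \<or> - c \<in> ?S (int r)" using F by blast
      then show ?thesis unfolding Fr by (metis abs_minus_cancel add_0_right order_refl)
    qed
    then show ?thesis using height_le_height_add[of _ _ 0] Cr Cs by (metis add_0_right)
  qed
  show "height (unitary_cyclotomic (p * q * r)) \<le> height (unitary_cyclotomic (p * q * s)) + 1"
  proof (rule height_le_height_add, unfold Cr Cs)
    fix c assume "c \<in> range (coeff (ternary r))"
    then have c: "c \<in> ?S (int r)" by (simp only: Fr)
    have "\<exists>y\<in>X. \<bar>y\<bar> = \<bar>x\<bar>" if "A = X \<or> A = uminus ` X" "x \<in> A" for x :: int and A X
      using that by auto
    from this[OF F c] obtain c' where c': "\<bar>c'\<bar> = \<bar>c\<bar>" "c' \<in> ?S (int s)" by (elim bexE)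
    then obtain g where "g \<in> range (coeff (ternary s))" "\<bar>c' - g\<bar> \<le> 1"
      using S_near_coeffs[OF s pq] by blast
    then show "\<exists>d\<in>range (coeff (ternary s)). \<bar>c\<bar> \<le> \<bar>d\<bar> + 1"
      using c'(1) by (intro bexI[of _ g]) linarith+
  qed
qed

theorem theorem9:
  fixes p q r s :: nat
  assumes "primepow p" "primepow q" "primepow r" "primepow s"
    and "p \<ge> 3" "q \<ge> 3" "r \<ge> 3" "s \<ge> 3"
    and "coprime p q" "coprime p r" "coprime p s" "coprime q r" "coprime q s" "coprime r s"
  shows "(\<exists>a b :: int. coeff_set (unitary_cyclotomic (p * q * r)) = {a..b}) \<and>
    (r > max p q \<and> s > max p q \<longrightarrow>
      ([int r = int s] (mod int (p * q)) \<longrightarrow>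
        coeff_set (unitary_cyclotomic (p * q * r)) = coeff_set (unitary_cyclotomic (p * q * s))) \<and>
      ([int r = - int s] (mod int (p * q)) \<longrightarrow>
        coeff_set (unitary_cyclotomic (p * q * r)) = uminus ` coeff_set (unitary_cyclotomic (p * q * s)))) \<and>
    (([int r = int s] (mod int (p * q)) \<or> [int r = - int s] (mod int (p * q))) \<and>
      r > max p q \<and> max p q > s \<longrightarrow>
      height (unitary_cyclotomic (p * q * s)) \<le> height (unitary_cyclotomic (p * q * r)) \<and>
      height (unitary_cyclotomic (p * q * r)) \<le> height (unitary_cyclotomic (p * q * s)) + 1)"
proof -
  obtain u v where "binary_grid p q u v"
    using binary_grid_exists[of p q] assms by auto
  then interpret binary_grid p q u v .
  have C: "coeff_set (unitary_cyclotomic (p * q * t)) = range (coeff (ternary t))"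
    if "t = r \<or> t = s" for t
    using zero_in_coeff_set[of p q t] coeff_set_eq_range[of "ternary t"] assms that
    by (auto simp: unitary_cyclotomic_eq_ternary)
  have "\<exists>a b. coeff_set (unitary_cyclotomic (p * q * r)) = {a..b}"
    using coeffs_interval[of r] C[of r] assms by simp
  moreover have "coeff_set (unitary_cyclotomic (p * q * r)) = coeff_set (unitary_cyclotomic (p * q * s))"
    if "r > max p q" "s > max p q" "[int r = int s] (mod int (p * q))"
    using coeffs_eq_range_S[of r] coeffs_eq_range_S[of s] range_S_cong[of "int r" "int s"] C assms that
    by (simp add: cong_iff_dvd_diff N_def)
  moreover have "coeff_set (unitary_cyclotomic (p * q * r)) = uminus ` coeff_set (unitary_cyclotomic (p * q * s))"
    if "r > max p q" "s > max p q" "[int r = - int s] (mod int (p * q))"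
    using coeffs_eq_range_S[of r] coeffs_eq_range_S[of s] range_S_cong[of "int r" "- int s"]
      range_S_uminus[of "int s"] C assms that
    by (simp add: cong_iff_dvd_diff N_def)
  moreover have "height (unitary_cyclotomic (p * q * s)) \<le> height (unitary_cyclotomic (p * q * r)) \<and>
      height (unitary_cyclotomic (p * q * r)) \<le> height (unitary_cyclotomic (p * q * s)) + 1"
    if "r > max p q" "[int r = int s] (mod int (p * q)) \<or> [int r = - int s] (mod int (p * q))"
  proof (cases "p < q")
    case True
    then show ?thesis using height_bounds[of p q r s] assms that by simp
  next
    case False
    \<comment> \<open>The claim is symmetric in \<open>p\<close> and \<open>q\<close>.\<close>
    then have "q < p" using pq_neq by simp
    moreover have "coprime q p" using assms by (simp add: coprime_commute)
    moreover have "p * q = q * p" by simp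
    ultimately show ?thesis
      using height_bounds[of q p r s] assms that by (simp only: max.commute)
  qed
  ultimately show ?thesis by blast
qed

end
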